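(* Let $V$ be an $n\times(n+r)$ integer matrix of maximal rank $n$ and let $Q=\mathcal G(V)$ be a Gale dual matrix of $V$. Let $I\subseteq\{1,\dots,n+r\}$ with $|I|=n$, so that $V_I$ (the columns of $V$ indexed by $I$) and $Q^I$ (the columns of $Q$ indexed by the complement of $I$) are square matrices of order $n$ and $r$, respectively. Then $$[\mathbb Z^n:\mathcal L_c(V)]\;\left|\det(Q^I)\right|=\left|\det(V_I)\right|.$$ In particular, if $\mathcal L_c(V)$ does not have cotorsion in $\mathbb Z^n$, then $|\det(Q^I)|=|\det(V_I)|$.
   Context: $n,r$ are positive integers. A Gale dual matrix $\mathcal G(V)$ of an $n\times(n+r)$ integer matrix $V$ of rank $n$ is an $r\times(n+r)$ integer matrix $Q$ whose rows form a $\mathbb Z$-basis of $\ker(V)\subseteq\mathbb Z^{n+r}$, where $V$ is viewed as a linear map $\mathbb Z^{n+r}\to\mathbb Z^n$; it is well defined up to left multiplication by $\mathrm{GL}_r(\mathbb Z)$. $\mathcal L_c(A)$ denotes the lattice spanned over $\mathbb Z$ by the columns of $A$. A subgroup $\mathcal L\subseteq\mathbb Z^m$ does not have cotorsion if $\mathbb Z^m/\mathcal L$ is torsion free. *)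

theory Defs
  imports
    "HOL-Algebra.Coset"
    "Jordan_Normal_Form.Determinant"
    "Jordan_Normal_Form.Matrix_Kernel"
    "Jordan_Normal_Form.DL_Rank"
    "Jordan_Normal_Form.DL_Submatrix"
begin

abbreviation int_span :: "nat \<Rightarrow> int vec set \<Rightarrow> int vec set" where
  "int_span m S \<equiv> LinearCombinations.module.span class_ring (module_vec TYPE(int) m) S"

abbreviation int_lin_indpt :: "nat \<Rightarrow> int vec set \<Rightarrow> bool" where
  "int_lin_indpt m S \<equiv> LinearCombinations.module.lin_indpt class_ring (module_vec TYPE(int) m) S"

definition col_lattice :: "int mat \<Rightarrow> int vec set" where
  "col_lattice A = int_span (dim_row A) (set (cols A))"

text \<open>\<open>distinct\<close> is needed because \<open>rows Q\<close> is a family, whereas linear independence and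
  span are notions for sets of vectors.\<close>

definition gale_dual :: "int mat \<Rightarrow> int mat \<Rightarrow> bool" where
  "gale_dual V Q \<longleftrightarrow>
     Q \<in> carrier_mat (dim_col V - dim_row V) (dim_col V) \<and>
     distinct (rows Q) \<and>
     int_lin_indpt (dim_col V) (set (rows Q)) \<and>
     int_span (dim_col V) (set (rows Q)) = mat_kernel V"

text \<open>By the convention for \<open>card\<close>, the index is \<open>0\<close> if there are infinitely many cosets.\<close>

definition subgroup_index :: "('a, 'b) monoid_scheme \<Rightarrow> 'a set \<Rightarrow> nat" where
  "subgroup_index G H = card (rcosets\<^bsub>G\<^esub> H)"

definition torsion_free :: "('a, 'b) monoid_scheme \<Rightarrow> bool" where
  "torsion_free G \<longleftrightarrow>
     (\<forall>x \<in> carrier G. \<forall>k::nat. k > 0 \<longrightarrow> x [^]\<^bsub>G\<^esub> k = \<one>\<^bsub>G\<^esub> \<longrightarrow> x = \<one>\<^bsub>G\<^esub>)"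

abbreviation int_lattice :: "nat \<Rightarrow> int vec monoid" where
  "int_lattice m \<equiv> monoid_vec TYPE(int) m"

definition no_cotorsion :: "nat \<Rightarrow> int vec set \<Rightarrow> bool" where
  "no_cotorsion m L \<longleftrightarrow> torsion_free (int_lattice m Mod L)"

end

theory Submission
  imports Defs
    "HOL-Algebra.Multiplicative_Group"
    "Jordan_Normal_Form.Column_Operations"
begin

text \<open>Write \<open>V\<^sub>I\<close> for the columns of \<open>V\<close> in \<open>I\<close>, and \<open>Q\<^sub>J\<close> for the columns of \<open>Q\<close> in the complement \<open>J\<close> of
\<open>I\<close>. The rows of \<open>Q\<close> generate the kernel of \<open>V\<close>, and a kernel is a direct summand of
\<open>\<int>\<^sup>n\<^sup>+\<^sup>r\<close>. So there is an integer matrix \<open>C\<close> such that \<open>[C, Q\<^sup>T]\<close> is unimodular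
(\<open>kernel_basis_completion\<close>); it comes from diagonalising \<open>V\<close> by unimodular row and column operations
(\<open>smith_diagonalisation\<close>). In the new coordinates \<open>V\<close> becomes \<open>[V C, 0]\<close>, where the square block
\<open>V C\<close> is nonsingular because \<open>V\<close> has full rank.

Two facts about \<open>V C\<close> give the formula. First, its columns generate the same lattice as those of \<open>V\<close>,
and the index of a lattice generated by a nonsingular square matrix is the absolute value of the
determinant (\<open>index_col_lattice_square\<close>). Hence \<open>\<bar>det (V C)\<bar>\<close> is the index of the column lattice of
\<open>V\<close>. Second, \<open>\<bar>det V\<^sub>I\<bar> = \<bar>det (V C)\<bar> \<bar>det Q\<^sub>J\<bar>\<close> (\<open>abs_det_submatrix_eq\<close>). To see this, extend \<open>V\<close>
to a square matrix by the unit row vectors that select the coordinates in \<open>J\<close>. Up to sign, its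
determinant is \<open>det V\<^sub>I\<close>, by a permutation of the columns, and it is also \<open>det (V C) det Q\<^sub>J\<close>, by
multiplication with \<open>[C, Q\<^sup>T]\<close>: both products are block triangular.

Since the index is finite, the quotient of \<open>\<int>\<^sup>n\<close> by the lattice is a finite group; if it is torsion
free, it is trivial and the index is \<open>1\<close>.\<close>

section \<open>Unimodular integer matrices\<close>

definition unimodular :: "nat \<Rightarrow> int mat \<Rightarrow> bool" where
  "unimodular n U \<longleftrightarrow> U \<in> carrier_mat n n \<and> \<bar>det U\<bar> = 1"

lemma unimodular_carrier: "unimodular n U \<Longrightarrow> U \<in> carrier_mat n n"
  by (simp add: unimodular_def)

lemma unimodular_one: "unimodular n (1\<^sub>m n)"
  by (simp add: unimodular_def)

lemma unimodular_mult:
  assumes "unimodular n P" and "unimodular n U"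
  shows "unimodular n (P * U)"
proof -
  have c: "P \<in> carrier_mat n n" "U \<in> carrier_mat n n" and d: "\<bar>det P\<bar> = 1" "\<bar>det U\<bar> = 1"
    using assms by (simp_all add: unimodular_def)
  have "\<bar>det (P * U)\<bar> = \<bar>det P\<bar> * \<bar>det U\<bar>"
    by (simp only: det_mult[OF c] abs_mult)
  then show ?thesis
    using mult_carrier_mat[OF c] by (simp add: unimodular_def d)
qed

lemma unimodular_factors:
  assumes "P \<in> carrier_mat n n" and "U \<in> carrier_mat n n" and "P * U = 1\<^sub>m n"
  shows "unimodular n P" and "unimodular n U"
proof -
  have "det P * det U = 1"
    using assms by (metis det_mult det_one)
  then have "\<bar>det P\<bar> * \<bar>det U\<bar> = 1"
    by (simp flip: abs_mult)
  then show "unimodular n P" "unimodular n U"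
    using assms(1,2) by (auto simp: unimodular_def zmult_eq_1_iff)
qed

text \<open>Since \<open>det U = \<plusminus>1\<close> is its own inverse, the adjugate identity \<open>U * adj U = det U\<close> yields an
integral inverse \<open>det U * adj U\<close>.\<close>

lemma unimodular_inverse:
  assumes U: "unimodular n U"
  obtains U' where "unimodular n U'" "U * U' = 1\<^sub>m n" "U' * U = 1\<^sub>m n"
proof -
  have c: "U \<in> carrier_mat n n" and d: "det U * det U = 1"
    using U by (auto simp: unimodular_def abs_if zmult_eq_1_iff split: if_splits)
  define U' where "U' = det U \<cdot>\<^sub>m adj_mat U"
  have c': "U' \<in> carrier_mat n n"
    using adj_mat(1)[OF c] by (simp add: U'_def)
  have "det U \<cdot>\<^sub>m (det U \<cdot>\<^sub>m 1\<^sub>m n) = 1\<^sub>m n"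
    using d by (intro eq_matI) auto
  then have "U * U' = 1\<^sub>m n" "U' * U = 1\<^sub>m n"
    using adj_mat[OF c] c d
    by (simp_all add: U'_def mult_smult_distrib[of U n n] mult_smult_assoc_mat[of _ n n])
  with unimodular_factors[OF c' c] c' that show thesis by blast
qed

lemma unimodular_block:
  assumes "unimodular m P" and "unimodular n U"
    and "A \<in> carrier_mat m n"
  shows "unimodular (m + n) (four_block_mat P A (0\<^sub>m n m) U)"
proof -
  have c: "P \<in> carrier_mat m m" "U \<in> carrier_mat n n" and d: "\<bar>det P\<bar> = 1" "\<bar>det U\<bar> = 1"
    using assms by (simp_all add: unimodular_def)
  have "\<bar>det (four_block_mat P A (0\<^sub>m n m) U)\<bar> = \<bar>det P\<bar> * \<bar>det U\<bar>"
    by (simp only: det_four_block_mat_lower_left_zero[OF c(1) assms(3) refl c(2)] abs_mult)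
  then show ?thesis
    using four_block_carrier_mat[OF c] by (simp add: unimodular_def d)
qed

lemma unimodular_swaprows:
  assumes "k < n" and "l < n"
  shows "unimodular n (swaprows_mat n k l)"
  by (rule unimodular_factors(1)[OF _ _ swaprows_mat_inv[OF assms]]) auto

lemma unimodular_addrow: "k \<noteq> l \<Longrightarrow> unimodular n (addrow_mat n a k l)"
  by (auto simp: unimodular_def det_addrow_mat)

section \<open>Diagonalisation by unimodular row and column operations\<close>

definition unimodular_equiv :: "int mat \<Rightarrow> int mat \<Rightarrow> bool" where
  "unimodular_equiv A B \<longleftrightarrow>
     (\<exists>P U. unimodular (dim_row A) P \<and> unimodular (dim_col A) U \<and> B = P * A * U)"

lemma unimodular_equiv_refl: "unimodular_equiv A A"
  unfolding unimodular_equiv_def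
  by (intro exI[of _ "1\<^sub>m (dim_row A)"] exI[of _ "1\<^sub>m (dim_col A)"])
    (simp add: unimodular_one)

lemma unimodular_equiv_dims:
  assumes "unimodular_equiv A B"
  shows "dim_row B = dim_row A" and "dim_col B = dim_col A"
  using assms by (auto simp: unimodular_equiv_def dest!: unimodular_carrier)

lemma unimodular_equiv_trans [trans]:
  assumes AB: "unimodular_equiv A B" and BC: "unimodular_equiv B C"
  shows "unimodular_equiv A C"
proof -
  define m k where "m = dim_row A" and "k = dim_col A"
  have A: "A \<in> carrier_mat m k" by (simp add: m_def k_def)
  obtain P U where 1: "unimodular m P" "unimodular k U" "B = P * A * U"
    using AB by (auto simp: unimodular_equiv_def m_def k_def)
  obtain P' U' where 2: "unimodular m P'" "unimodular k U'" "C = P' * B * U'"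
    using BC unimodular_equiv_dims[OF AB] by (auto simp: unimodular_equiv_def m_def k_def)
  note cs = A unimodular_carrier[OF 1(1)] unimodular_carrier[OF 1(2)]
    unimodular_carrier[OF 2(1)] unimodular_carrier[OF 2(2)]
  have "C = P' * (P * A) * U * U'"
    using cs by (simp add: 1 2 assoc_mult_mat[of _ m m _ k _ k])
  also have "\<dots> = (P' * P) * A * (U * U')"
    using cs by (simp add: assoc_mult_mat[of _ m m _ m _ k] assoc_mult_mat[of _ m k _ k _ k]
        assoc_mult_mat[of _ m m _ k _ k])
  finally show ?thesis
    using unimodular_mult[OF 2(1) 1(1)] unimodular_mult[OF 1(2) 2(2)]
    by (auto simp: unimodular_equiv_def m_def k_def)
qed

lemma unimodular_equiv_left:
  assumes "A \<in> carrier_mat m k" and "unimodular m P"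
  shows "unimodular_equiv A (P * A)"
  unfolding unimodular_equiv_def using assms unimodular_one
  by (intro exI[of _ P] exI[of _ "1\<^sub>m k"]) (auto dest: unimodular_carrier)

lemma unimodular_equiv_right:
  assumes "A \<in> carrier_mat m k" and "unimodular k U"
  shows "unimodular_equiv A (A * U)"
  unfolding unimodular_equiv_def using assms unimodular_one
  by (intro exI[of _ "1\<^sub>m m"] exI[of _ U]) (auto dest: unimodular_carrier)

lemma unimodular_equiv_swaprows:
  assumes A: "A \<in> carrier_mat m k" and "i < m" and "j < m"
  shows "unimodular_equiv A (swaprows i j A)"
  unfolding swaprows_mat[OF assms] using assms
  by (intro unimodular_equiv_left[OF A] unimodular_swaprows)

lemma unimodular_equiv_swapcols:
  assumes A: "A \<in> carrier_mat m k" and "i < k" and "j < k"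
  shows "unimodular_equiv A (swapcols i j A)"
  unfolding swapcols_mat[OF assms] using assms
  by (intro unimodular_equiv_right[OF A] unimodular_swaprows)

lemma unimodular_equiv_addrow:
  assumes A: "A \<in> carrier_mat m k" and "j < m" and "i \<noteq> j"
  shows "unimodular_equiv A (addrow a i j A)"
  unfolding addrow_mat[OF assms(1,2)] using assms
  by (intro unimodular_equiv_left[OF A] unimodular_addrow) auto

lemma unimodular_equiv_addcol:
  assumes A: "A \<in> carrier_mat m k" and "j < k" and "i \<noteq> j"
  shows "unimodular_equiv A (addcol a i j A)"
  unfolding addcol_mat[OF assms(1,2)] using assms
  by (intro unimodular_equiv_right[OF A] unimodular_addrow) auto

text \<open>Among all matrices equivalent to \<open>A\<close> that have a nonzero upper left entry, take one for which that
entry is smallest in absolute value. If it failed to divide some entry of its row or column, the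
remainder of the division would be nonzero and smaller, and one subtraction and one swap would bring
it to the upper left corner.\<close>

lemma exists_dividing_pivot:
  assumes A: "A \<in> carrier_mat (Suc m) (Suc k)" and nz: "A \<noteq> 0\<^sub>m (Suc m) (Suc k)"
  obtains B where "unimodular_equiv A B"
    and "\<And>i. i < Suc m \<Longrightarrow> B $$ (0, 0) dvd B $$ (i, 0)"
    and "\<And>j. j < Suc k \<Longrightarrow> B $$ (0, 0) dvd B $$ (0, j)"
proof -
  define Z where "Z B \<longleftrightarrow> unimodular_equiv A B \<and> B $$ (0, 0) \<noteq> 0" for B
  have "\<exists>B. Z B"
  proof -
    obtain i j where ij: "i < Suc m" "j < Suc k" "A $$ (i, j) \<noteq> 0"
      using nz A by (metis carrier_matD eq_matI index_zero_mat)
    let ?R = "swaprows 0 i A"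
    have R: "?R \<in> carrier_mat (Suc m) (Suc k)" using A by simp
    have "unimodular_equiv A ?R"
      by (rule unimodular_equiv_swaprows[OF A]) (use ij in auto)
    also have "unimodular_equiv ?R (swapcols 0 j ?R)"
      by (rule unimodular_equiv_swapcols[OF R]) (use ij in auto)
    finally show ?thesis
      using ij A by (intro exI[of _ "swapcols 0 j ?R"]) (auto simp: Z_def)
  qed
  then obtain B where B: "Z B" and min: "\<And>C. Z C \<Longrightarrow> nat \<bar>B $$ (0,0)\<bar> \<le> nat \<bar>C $$ (0,0)\<bar>"
    using arg_min_nat_lemma[of Z _ "\<lambda>C. nat \<bar>C $$ (0,0)\<bar>"] by blast
  have eq: "unimodular_equiv A B" and b: "B $$ (0,0) \<noteq> 0" using B by (auto simp: Z_def)
  have cB: "B \<in> carrier_mat (Suc m) (Suc k)"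
    using unimodular_equiv_dims[OF eq] A by (metis carrier_matD carrier_matI)
  have small: "B $$ (0,0) dvd c" if "unimodular_equiv B C" "C $$ (0,0) = c mod B $$ (0,0)" for C c
  proof (rule ccontr)
    assume "\<not> B $$ (0,0) dvd c"
    then have nz: "c mod B $$ (0,0) \<noteq> 0" by (simp add: dvd_eq_mod_eq_0)
    then have "Z C" using unimodular_equiv_trans[OF eq] that by (auto simp: Z_def)
    from min[OF this] abs_mod_less[OF b, of c] show False
      by (simp add: that(2))
  qed
  have row: "B $$ (0,0) dvd B $$ (i,0)" if i: "i < Suc m" for i
  proof (cases "i = 0")
    case False
    let ?q = "B $$ (i,0) div B $$ (0,0)"
    let ?C = "addrow (- ?q) i 0 B"
    have cC: "?C \<in> carrier_mat (Suc m) (Suc k)" using cB by simp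
    have "unimodular_equiv B ?C"
      by (rule unimodular_equiv_addrow[OF cB]) (use False in auto)
    also have "unimodular_equiv ?C (swaprows 0 i ?C)"
      by (rule unimodular_equiv_swaprows[OF cC]) (use i in auto)
    finally show ?thesis
      by (rule small) (use i cB False in \<open>simp add: minus_div_mult_eq_mod[symmetric]\<close>)
  qed simp
  have col: "B $$ (0,0) dvd B $$ (0,j)" if j: "j < Suc k" for j
  proof (cases "j = 0")
    case False
    let ?q = "B $$ (0,j) div B $$ (0,0)"
    let ?C = "addcol (- ?q) j 0 B"
    have cC: "?C \<in> carrier_mat (Suc m) (Suc k)" using cB by (auto simp: mat_addcol_def)
    have "unimodular_equiv B ?C"
      by (rule unimodular_equiv_addcol[OF cB]) (use False j in auto)
    also have "unimodular_equiv ?C (swapcols 0 j ?C)"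
      by (rule unimodular_equiv_swapcols[OF cC]) (use j in auto)
    finally show ?thesis
      by (rule small) (use j cB False in \<open>simp add: minus_div_mult_eq_mod[symmetric]\<close>)
  qed simp
  from that[OF eq row col] show thesis .
qed

text \<open>Once the pivot \<open>b\<close> divides its row and its column, the matrix has the block form
\<open>[b, b x; y b, W]\<close>; subtracting \<open>y\<close> times the first row and then the first column times \<open>x\<close>
clears both.\<close>

lemma block_reduction:
  assumes A: "A \<in> carrier_mat (Suc m) (Suc k)"
  obtains b C where "C \<in> carrier_mat m k"
    and "unimodular_equiv A (four_block_mat (mat 1 1 (\<lambda>_. b)) (0\<^sub>m 1 k) (0\<^sub>m m 1) C)"
proof (cases "A = 0\<^sub>m (Suc m) (Suc k)")
  case True
  then have "A = four_block_mat (mat 1 1 (\<lambda>_. 0)) (0\<^sub>m 1 k) (0\<^sub>m m 1) (0\<^sub>m m k)"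
    by (intro eq_matI) auto
  then show thesis
    using that[of "0\<^sub>m m k" 0] unimodular_equiv_refl[of A] by auto
next
  case False
  obtain B where eq: "unimodular_equiv A B"
    and row: "\<And>i. i < Suc m \<Longrightarrow> B $$ (0, 0) dvd B $$ (i, 0)"
    and col: "\<And>j. j < Suc k \<Longrightarrow> B $$ (0, 0) dvd B $$ (0, j)"
    using exists_dividing_pivot[OF A False] by blast
  have cB: "B \<in> carrier_mat (Suc m) (Suc k)"
    using unimodular_equiv_dims[OF eq] A by (metis carrier_matD carrier_matI)
  define b where "b = B $$ (0,0)"
  define x where "x = mat 1 k (\<lambda>(i,j). B $$ (0, Suc j) div b)"
  define y where "y = mat m 1 (\<lambda>(i,j). B $$ (Suc i, 0) div b)"
  define W where "W = mat m k (\<lambda>(i,j). B $$ (Suc i, Suc j))"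
  let ?b = "mat 1 1 (\<lambda>_. b)"
  have cs: "x \<in> carrier_mat 1 k" "y \<in> carrier_mat m 1" "W \<in> carrier_mat m k"
    by (auto simp: x_def y_def W_def)
  have Bblk: "B = four_block_mat ?b (?b * x) (y * ?b) W"
    using row col cB
    by (intro eq_matI)
      (auto simp: b_def x_def y_def W_def scalar_prod_def less_Suc_eq_0_disj)
  define L where "L = four_block_mat (1\<^sub>m 1) (0\<^sub>m 1 m) (- y) (1\<^sub>m m)"
  define R where "R = four_block_mat (1\<^sub>m 1) (- x) (0\<^sub>m k 1) (1\<^sub>m k)"
  have uR: "unimodular (Suc k) R"
    using unimodular_block[OF unimodular_one[of 1] unimodular_one[of k], of "- x"] cs(1)
    by (simp add: R_def)
  have "L \<in> carrier_mat (1 + m) (1 + m)"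
    unfolding L_def using cs by (intro four_block_carrier_mat) auto
  moreover have "det L = 1"
    unfolding L_def using cs by (subst det_four_block_mat_upper_right_zero[of _ 1 _ m]) auto
  ultimately have uL: "unimodular (Suc m) L"
    by (simp add: unimodular_def)
  have LB: "L * B = four_block_mat ?b (?b * x) (0\<^sub>m m 1) (- y * (?b * x) + W)"
    unfolding L_def Bblk using cs
    by (subst mult_four_block_mat[of _ 1 1 _ m _ m _ _ 1 _ k])
      (auto intro!: cong_four_block_mat uminus_l_inv_mat)
  have LBR: "L * B * R = four_block_mat ?b (0\<^sub>m 1 k) (0\<^sub>m m 1) (- y * (?b * x) + W)"
    unfolding LB R_def using cs
    by (subst mult_four_block_mat[of _ 1 1 _ k _ m _ _ 1 _ k])
      (auto intro!: cong_four_block_mat uminus_l_inv_mat)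
  have cLB: "L * B \<in> carrier_mat (Suc m) (Suc k)"
    using uL cB by (auto dest: unimodular_carrier)
  note eq
  also have "unimodular_equiv B (L * B)" by (rule unimodular_equiv_left[OF cB uL])
  also have "unimodular_equiv (L * B) (L * B * R)" by (rule unimodular_equiv_right[OF cLB uR])
  finally show thesis
    using that[of "- y * (?b * x) + W" b] cs by (auto simp: LBR)
qed

text \<open>The Smith normal form, without the divisibility chain between the diagonal entries: block reduction
splits off one diagonal entry, and the remaining block is diagonalised by induction.\<close>

lemma smith_diagonalisation:
  assumes "A \<in> carrier_mat m k"
  obtains D where "unimodular_equiv A D" and "diagonal_mat D"
  using assms
proof (induction m arbitrary: A k thesis)
  case 0
  then have "diagonal_mat A" by (simp add: diagonal_mat_def)
  with unimodular_equiv_refl show ?case by (rule "0.prems"(1))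
next
  case (Suc m)
  show ?case
  proof (cases k)
    case 0
    then have "diagonal_mat A" using Suc.prems(2) by (simp add: diagonal_mat_def)
    with unimodular_equiv_refl show ?thesis by (rule Suc.prems(1))
  next
    case (Suc k')
    let ?blk = "\<lambda>b C. four_block_mat (mat 1 1 (\<lambda>_. b)) (0\<^sub>m 1 k') (0\<^sub>m m 1) C"
    obtain b C where C: "C \<in> carrier_mat m k'" and eq: "unimodular_equiv A (?blk b C)"
      using block_reduction Suc.prems(2) Suc by blast
    obtain D where D: "unimodular_equiv C D" and diag: "diagonal_mat D"
      using Suc.IH[OF _ C] by blast
    then obtain P U where PU: "unimodular m P" "unimodular k' U" "D = P * C * U"
      using C by (auto simp: unimodular_equiv_def)
    have cD: "D \<in> carrier_mat m k'"
      using unimodular_equiv_dims[OF D] C by (metis carrier_matD carrier_matI)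
    note cs = C unimodular_carrier[OF PU(1)] unimodular_carrier[OF PU(2)]
    let ?P = "four_block_mat (1\<^sub>m 1) (0\<^sub>m 1 m) (0\<^sub>m m 1) P"
    let ?U = "four_block_mat (1\<^sub>m 1) (0\<^sub>m 1 k') (0\<^sub>m k' 1) U"
    have "?P * ?blk b C = ?blk b (P * C)"
      using cs by (subst mult_four_block_mat[of _ 1 1 _ m _ m _ _ 1 _ k'])
        (auto intro!: cong_four_block_mat)
    also have "\<dots> * ?U = ?blk b D"
      using cs PU(3) by (subst mult_four_block_mat[of _ 1 1 _ k' _ m _ _ 1 _ k'])
        (auto intro!: cong_four_block_mat)
    finally have "unimodular_equiv (?blk b C) (?blk b D)"
      unfolding unimodular_equiv_def
      using unimodular_block[OF unimodular_one[of 1] PU(1), of "0\<^sub>m 1 m"]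
        unimodular_block[OF unimodular_one[of 1] PU(2), of "0\<^sub>m 1 k'"] C
      by (intro exI[of _ ?P] exI[of _ ?U]) auto
    with eq have "unimodular_equiv A (?blk b D)" by (rule unimodular_equiv_trans)
    moreover have "diagonal_mat (?blk b D)"
      using diag cD by (auto simp: diagonal_mat_def)
    ultimately show ?thesis using Suc.prems(1) by blast
  qed
qed

section \<open>Column lattices\<close>

lemma int_span_cols:
  fixes A :: "int mat"
  assumes A: "A \<in> carrier_mat m k"
  shows "int_span m (set (cols A)) = (*\<^sub>v) A ` carrier_vec k"
proof -
  interpret idom_vec m "TYPE(int)" .
  have cols: "set (cols A) \<subseteq> carrier_vec m"
    using A cols_dim by blast
  have comb: "lincomb_list c (cols A) = A *\<^sub>v vec k c" for c
    using A cols by (subst lincomb_list_as_mat_mult) auto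
  have "int_span m (set (cols A)) = (*\<^sub>v) A ` range (vec k)"
    unfolding span_list_as_span[OF cols, symmetric] span_list_def comb by auto
  also have "range (vec k) = (carrier_vec k :: int vec set)"
    by (metis (no_types) UNIV_eq_I carrier_vecD eq_vecI subsetI equalityI image_subsetI index_vec dim_vec rangeI vec_carrier)
  finally show ?thesis .
qed

lemma col_lattice_eq:
  assumes A: "A \<in> carrier_mat m k"
  shows "col_lattice A = (*\<^sub>v) A ` carrier_vec k"
  using int_span_cols[OF A] A by (simp add: col_lattice_def)

lemma unimodular_mult_vec_bij:
  assumes U: "unimodular n U"
  shows "bij_betw ((*\<^sub>v) U) (carrier_vec n) (carrier_vec n)"
proof -
  obtain U' where U': "unimodular n U'" "U * U' = 1\<^sub>m n" "U' * U = 1\<^sub>m n"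
    using unimodular_inverse[OF U] .
  note c = unimodular_carrier[OF U] unimodular_carrier[OF U'(1)]
  show ?thesis
    by (rule bij_betw_byWitness[where f' = "(*\<^sub>v) U'"])
      (use c in \<open>auto simp: U' simp flip: assoc_mult_mat_vec[of _ n n _ n]\<close>)
qed

lemma col_lattice_mult:
  assumes A: "A \<in> carrier_mat m k" and B: "B \<in> carrier_mat k l"
  shows "col_lattice (A * B) = (*\<^sub>v) A ` col_lattice B"
  unfolding col_lattice_eq[OF mult_carrier_mat[OF A B]] col_lattice_eq[OF B] image_image
  by (intro image_cong refl assoc_mult_mat_vec[OF A B])

lemma col_lattice_mult_unimodular:
  assumes A: "A \<in> carrier_mat m k" and U: "unimodular k U"
  shows "col_lattice (A * U) = col_lattice A"
  using unimodular_mult_vec_bij[OF U]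
  by (simp add: col_lattice_mult[OF A unimodular_carrier[OF U]] bij_betw_def
      col_lattice_eq[OF A] col_lattice_eq[OF unimodular_carrier[OF U]])

lemma diagonal_mult_vec_index:
  fixes D :: "int mat"
  assumes D: "D \<in> carrier_mat n n" and diag: "diagonal_mat D" and "x \<in> carrier_vec n" and i: "i < n"
  shows "(D *\<^sub>v x) $ i = D $$ (i, i) * x $ i"
proof -
  have "(D *\<^sub>v x) $ i = (\<Sum>j = 0..<n. D $$ (i, j) * x $ j)"
    using assms by (simp add: scalar_prod_def)
  also have "\<dots> = (\<Sum>j = 0..<n. if j = i then D $$ (i, i) * x $ i else 0)"
    using assms by (intro sum.cong) (auto simp: diagonal_mat_def)
  finally show ?thesis using i by simp
qed

lemma mem_col_lattice_diagonal:
  assumes D: "D \<in> carrier_mat n n" and diag: "diagonal_mat D"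
  shows "z \<in> col_lattice D \<longleftrightarrow> z \<in> carrier_vec n \<and> (\<forall>i<n. D $$ (i, i) dvd z $ i)"
proof
  assume "z \<in> col_lattice D"
  then show "z \<in> carrier_vec n \<and> (\<forall>i<n. D $$ (i, i) dvd z $ i)"
    using D by (auto simp: col_lattice_eq[OF D] diagonal_mult_vec_index[OF D diag])
next
  assume z: "z \<in> carrier_vec n \<and> (\<forall>i<n. D $$ (i, i) dvd z $ i)"
  have "z = D *\<^sub>v vec n (\<lambda>i. z $ i div D $$ (i, i))"
    using z D
    by (intro eq_vecI) (auto simp: diagonal_mult_vec_index[OF D diag] simp del: index_mult_mat_vec)
  then show "z \<in> col_lattice D"
    by (auto simp: col_lattice_eq[OF D])
qed

section \<open>The index of a full-rank lattice\<close>

lemma int_lattice_inv: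
  assumes "x \<in> carrier_vec n"
  shows "inv\<^bsub>int_lattice n\<^esub> x = - x"
proof -
  interpret comm_group "int_lattice n" by (rule comm_group_vec)
  show ?thesis using assms
    by (intro inv_equality) (auto simp: monoid_vec_simps)
qed

lemma subgroup_col_lattice:
  assumes A: "A \<in> carrier_mat n k"
  shows "subgroup (col_lattice A) (int_lattice n)"
proof -
  interpret comm_group "int_lattice n" by (rule comm_group_vec)
  show ?thesis
  proof (rule subgroupI)
    show "col_lattice A \<subseteq> carrier (int_lattice n)"
      using A by (auto simp: col_lattice_eq[OF A] monoid_vec_simps)
    show "col_lattice A \<noteq> {}"
      unfolding col_lattice_eq[OF A] using zero_carrier_vec by blast
  next
    fix a assume "a \<in> col_lattice A"
    then obtain x where x: "x \<in> carrier_vec k" "a = A *\<^sub>v x"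
      by (auto simp: col_lattice_eq[OF A])
    then have "- a = A *\<^sub>v (- x)"
      using A by (intro eq_vecI) auto
    then show "inv\<^bsub>int_lattice n\<^esub> a \<in> col_lattice A"
      using x A by (auto simp: col_lattice_eq[OF A] int_lattice_inv)
  next
    fix a b assume "a \<in> col_lattice A" "b \<in> col_lattice A"
    then obtain x y where x: "x \<in> carrier_vec k" "a = A *\<^sub>v x" and y: "y \<in> carrier_vec k" "b = A *\<^sub>v y"
      by (auto simp: col_lattice_eq[OF A])
    then have "a + b = A *\<^sub>v (x + y)"
      using A by (simp add: mult_add_distrib_mat_vec)
    then show "a \<otimes>\<^bsub>int_lattice n\<^esub> b \<in> col_lattice A"
      using x y by (auto simp: col_lattice_eq[OF A] monoid_vec_simps)
  qed
qed

text \<open>A map that separates exactly the cosets of \<open>H\<close> is constant on each of them, so it counts them by its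
values.\<close>

lemma rcosets_bij_betw_invariant:
  assumes G: "group G" and H: "subgroup H G"
    and inv: "\<And>x y. x \<in> carrier G \<Longrightarrow> y \<in> carrier G \<Longrightarrow>
      f x = f y \<longleftrightarrow> x \<otimes>\<^bsub>G\<^esub> inv\<^bsub>G\<^esub> y \<in> H"
  shows "bij_betw (\<lambda>C. the_elem (f ` C)) (rcosets\<^bsub>G\<^esub> H) (f ` carrier G)"
proof -
  interpret group G by fact
  have coset: "H #>\<^bsub>G\<^esub> x = {y \<in> carrier G. f y = f x}" if x: "x \<in> carrier G" for x
  proof -
    have "y \<in> H #>\<^bsub>G\<^esub> x \<longleftrightarrow> y \<in> carrier G \<and> f y = f x" for y
      using subgroup.rcos_module[OF H G x, of y] inv[of y x] x
        subsetD[OF r_coset_subset_G[OF subgroup.subset[OF H] x], of y] by blast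
    then show ?thesis by blast
  qed
  have val: "the_elem (f ` (H #>\<^bsub>G\<^esub> x)) = f x" if x: "x \<in> carrier G" for x
  proof -
    have "f ` (H #>\<^bsub>G\<^esub> x) = {f x}" using x by (auto simp: coset)
    then show ?thesis by simp
  qed
  show ?thesis
    unfolding bij_betw_def RCOSETS_def
  proof
    show "inj_on (\<lambda>C. the_elem (f ` C)) (\<Union>a\<in>carrier G. {H #>\<^bsub>G\<^esub> a})"
      by (rule inj_onI) (auto simp: val, auto simp: coset)
    show "(\<lambda>C. the_elem (f ` C)) ` (\<Union>a\<in>carrier G. {H #>\<^bsub>G\<^esub> a}) = f ` carrier G"
      by (force simp: val)
  qed
qed

lemma det_diagonal:
  fixes D :: "int mat"
  assumes "D \<in> carrier_mat n n" and "diagonal_mat D"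
  shows "det D = (\<Prod>i<n. D $$ (i, i))"
  using assms
  by (subst det_upper_triangular[of _ n])
    (auto simp: diagonal_mat_def upper_triangular_def prod_list_diag_prod atLeast0LessThan)

text \<open>If \<open>P H U\<close> is the diagonal matrix with entries \<open>d i\<close>, then \<open>y\<close> lies in the lattice of \<open>H\<close> exactly
when \<open>d i\<close> divides \<open>(P y) i\<close> for all \<open>i\<close>. Hence the residues of the coordinates of \<open>P y\<close> modulo the
\<open>d i\<close> form a complete invariant of the coset of \<open>y\<close>. As \<open>P\<close> is onto, all tuples of residues occur,
and their number is \<open>\<Prod>i. \<bar>d i\<bar> = \<bar>det H\<bar>\<close>.\<close>

lemma index_col_lattice_square:
  assumes H: "H \<in> carrier_mat n n" and nz: "det H \<noteq> 0"
  shows "finite (rcosets\<^bsub>int_lattice n\<^esub> (col_lattice H))"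
    and "int (subgroup_index (int_lattice n) (col_lattice H)) = \<bar>det H\<bar>"
proof -
  obtain D where "unimodular_equiv H D" and diag: "diagonal_mat D"
    using smith_diagonalisation[OF H] .
  then obtain P U where P: "unimodular n P" and U: "unimodular n U" and D: "D = P * H * U"
    using H by (auto simp: unimodular_equiv_def)
  note cP = unimodular_carrier[OF P] and cU = unimodular_carrier[OF U]
  have cPH: "P * H \<in> carrier_mat n n" and cD: "D \<in> carrier_mat n n"
    using cP cU H by (auto simp: D)
  have detD: "\<bar>det D\<bar> = \<bar>det H\<bar>"
    using P U by (simp add: D det_mult[OF cPH cU] det_mult[OF cP H] abs_mult unimodular_def)
  define d where "d i = D $$ (i, i)" for i
  have d: "d i \<noteq> 0" if "i < n" for i
  proof -
    have "det D \<noteq> 0" using nz detD by auto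
    then show ?thesis using that by (auto simp: det_diagonal[OF cD diag] d_def)
  qed
  have bij: "bij_betw ((*\<^sub>v) P) (carrier_vec n) (carrier_vec n)"
    by (rule unimodular_mult_vec_bij[OF P])
  have mem: "y \<in> col_lattice H \<longleftrightarrow> (\<forall>i<n. d i dvd (P *\<^sub>v y) $ i)" if y: "y \<in> carrier_vec n" for y
  proof -
    have "col_lattice D = (*\<^sub>v) P ` col_lattice H"
      by (simp add: D col_lattice_mult_unimodular[OF cPH U] col_lattice_mult[OF cP H])
    moreover have "col_lattice H \<subseteq> carrier_vec n"
      using H by (auto simp: col_lattice_eq[OF H])
    ultimately have "y \<in> col_lattice H \<longleftrightarrow> P *\<^sub>v y \<in> col_lattice D"
      using bij y by (auto simp: bij_betw_def dest: inj_onD)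
    then show ?thesis
      using mem_col_lattice_diagonal[OF cD diag] cP y by (auto simp: d_def)
  qed
  \<comment> \<open>The coset invariant, and the residues that its coordinate \<open>i\<close> can take;
    these are nonpositive when \<open>d i\<close> is negative.\<close>
  define f where "f y = (\<lambda>i\<in>{..<n}. (P *\<^sub>v y) $ i mod d i)" for y
  define R where "R i = (\<lambda>z. z mod d i) ` (UNIV :: int set)" for i
  have R: "finite (R i)" "card (R i) = nat \<bar>d i\<bar>" if "i < n" for i
  proof -
    have "R i = {z. z mod d i = z}"
      by (auto simp: R_def image_iff) (metis)
    also have "\<dots> = (if d i > 0 then {0..<d i} else {d i<..0})"
      using d[OF that] by (auto simp: zmod_trivial_iff)
    finally have "R i = (if d i > 0 then {0..<d i} else {d i<..0})" .
    then show "finite (R i)" "card (R i) = nat \<bar>d i\<bar>" using d[OF that] by auto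
  qed
  have "f x = f y \<longleftrightarrow> x - y \<in> col_lattice H" if x: "x \<in> carrier_vec n" and y: "y \<in> carrier_vec n" for x y
  proof -
    have "f x = f y \<longleftrightarrow> (\<forall>i<n. (P *\<^sub>v x) $ i mod d i = (P *\<^sub>v y) $ i mod d i)"
      by (auto simp: f_def restrict_def fun_eq_iff)
    also have "\<dots> \<longleftrightarrow> (\<forall>i<n. d i dvd (P *\<^sub>v (x - y)) $ i)"
      using x y cP by (simp add: mult_minus_distrib_mat_vec mod_eq_dvd_iff)
    finally show ?thesis using mem[of "x - y"] x y by simp
  qed
  moreover have "x \<otimes>\<^bsub>int_lattice n\<^esub> inv\<^bsub>int_lattice n\<^esub> y = x - y"
    if "x \<in> carrier_vec n" "y \<in> carrier_vec n" for x y
    using that by (auto simp: int_lattice_inv monoid_vec_simps)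
  ultimately have "bij_betw (\<lambda>C. the_elem (f ` C)) (rcosets\<^bsub>int_lattice n\<^esub> (col_lattice H))
      (f ` carrier (int_lattice n))"
    using comm_group.axioms(2)[OF comm_group_vec] subgroup_col_lattice[OF H]
    by (intro rcosets_bij_betw_invariant) (auto simp: monoid_vec_simps)
  also have "f ` carrier (int_lattice n) = (\<lambda>z. \<lambda>i\<in>{..<n}. z $ i mod d i) ` ((*\<^sub>v) P ` carrier_vec n)"
    by (simp add: image_image f_def monoid_vec_simps)
  also have "(*\<^sub>v) P ` carrier_vec n = carrier_vec n"
    using bij by (simp add: bij_betw_def)
  also have "(\<lambda>z. \<lambda>i\<in>{..<n}. z $ i mod d i) ` carrier_vec n = Pi\<^sub>E {..<n} R"
  proof (intro equalityI subsetI)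
    fix g assume "g \<in> (\<lambda>z. \<lambda>i\<in>{..<n}. z $ i mod d i) ` carrier_vec n"
    then obtain z where "g = (\<lambda>i\<in>{..<n}. z $ i mod d i)" by blast
    then show "g \<in> Pi\<^sub>E {..<n} R"
      by (simp only: restrict_PiE_iff R_def) blast
  next
    fix g assume g: "g \<in> Pi\<^sub>E {..<n} R"
    have "g i mod d i = g i" if "i < n" for i
      using PiE_mem[OF g, of i] that by (auto simp: R_def)
    then have "g = (\<lambda>i\<in>{..<n}. vec n g $ i mod d i)"
      using g by (auto simp: restrict_def PiE_def extensional_def fun_eq_iff)
    then show "g \<in> (\<lambda>z. \<lambda>i\<in>{..<n}. z $ i mod d i) ` carrier_vec n"
      by (intro image_eqI[of _ _ "vec n g"]) auto
  qed
  finally have b: "bij_betw (\<lambda>C. the_elem (f ` C)) (rcosets\<^bsub>int_lattice n\<^esub> (col_lattice H)) (Pi\<^sub>E {..<n} R)" .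
  show "finite (rcosets\<^bsub>int_lattice n\<^esub> (col_lattice H))"
    using bij_betw_finite[OF b] R by (auto intro: finite_PiE)
  have "int (subgroup_index (int_lattice n) (col_lattice H)) = (\<Prod>i<n. int (card (R i)))"
    by (simp add: subgroup_index_def bij_betw_same_card[OF b] card_PiE)
  also have "\<dots> = \<bar>det H\<bar>"
    by (simp add: R detD[symmetric] det_diagonal[OF cD diag] abs_prod d_def)
  finally show "int (subgroup_index (int_lattice n) (col_lattice H)) = \<bar>det H\<bar>" .
qed

text \<open>In a finite group every element is torsion, so a finite torsion-free quotient is trivial.\<close>

lemma finite_torsion_free_index:
  assumes G: "comm_group G" and H: "subgroup H G" and fin: "finite (rcosets\<^bsub>G\<^esub> H)"
    and tf: "torsion_free (G Mod H)"
  shows "subgroup_index G H = 1"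
proof -
  interpret G: comm_group G by fact
  interpret normal H G by (rule G.subgroup_imp_normal[OF H])
  interpret F: group "G Mod H" by (rule factorgroup_is_group)
  have c: "carrier (G Mod H) = rcosets\<^bsub>G\<^esub> H" by (simp add: FactGroup_def)
  have "Coset.order (G Mod H) > 0"
    using F.order_gt_0_iff_finite fin c by simp
  then have "x = \<one>\<^bsub>G Mod H\<^esub>" if "x \<in> carrier (G Mod H)" for x
    using tf F.pow_order_eq_1[OF that] that unfolding torsion_free_def by blast
  then have "carrier (G Mod H) = {\<one>\<^bsub>G Mod H\<^esub>}"
    using F.one_closed by blast
  then show ?thesis
    unfolding subgroup_index_def c[symmetric] by simp
qed

section \<open>Integer matrices of full row rank\<close>

lemma full_rank_col_space:
  fixes A :: "'a::field mat"
  assumes A: "A \<in> carrier_mat n k" and rank: "vec_space.rank n A = n"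
  shows "(*\<^sub>v) A ` carrier_vec k = carrier_vec n"
proof -
  interpret vec_space "TYPE('a)" n .
  have cols: "set (cols A) \<subseteq> carrier_vec n"
    using A cols_dim by blast
  obtain S where S: "maximal S (\<lambda>T. T \<subseteq> set (cols A) \<and> lin_indpt T)"
    using maximal_exists_superset[of "set (cols A)" "\<lambda>T. T \<subseteq> set (cols A) \<and> lin_indpt T" "{}"]
      finite_lin_indpt2 by auto
  then have S': "S \<subseteq> set (cols A)" "lin_indpt S"
    by (auto simp: maximal_def)
  have "card S = n"
    using rank_card_indpt[OF A S] rank by simp
  then have "basis S"
    using S' cols by (intro dim_li_is_basis) (auto simp: dim_is_n intro: finite_subset)
  then have "span S = carrier_vec n"
    by (simp add: basis_def)
  then have "col_space A = carrier_vec n"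
    using span_is_monotone[OF S'(1)] span_closed[OF cols] unfolding col_space_def by blast
  then have surj: "\<exists>x\<in>carrier_vec k. A *\<^sub>v x = y" if "y \<in> carrier_vec n" for y
    using that A by (auto simp: col_space_eq[OF A])
  show ?thesis
  proof
    show "(*\<^sub>v) A ` carrier_vec k \<subseteq> carrier_vec n" using A by auto
    show "carrier_vec n \<subseteq> (*\<^sub>v) A ` carrier_vec k" using surj by blast
  qed
qed

text \<open>Over the rationals the columns of \<open>A\<close> span everything, so a vector orthogonal to all of them is orthogonal
to every unit vector.\<close>

lemma full_rank_left_kernel:
  fixes A :: "int mat"
  assumes A: "A \<in> carrier_mat n k" and rank: "vec_space.rank n (map_mat rat_of_int A) = n"
    and y: "y \<in> carrier_vec n" and ker: "transpose_mat A *\<^sub>v y = 0\<^sub>v k"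
  shows "y = 0\<^sub>v n"
proof (rule eq_vecI)
  fix i assume "i < dim_vec (0\<^sub>v n :: int vec)"
  then have i: "i < n" by simp
  let ?A = "map_mat rat_of_int A" and ?y = "map_vec rat_of_int y"
  have cA: "?A \<in> carrier_mat n k" using A by simp
  have cy: "?y \<in> carrier_vec n" using y by simp
  have "unit_vec n i \<in> (*\<^sub>v) ?A ` carrier_vec k"
    by (simp add: full_rank_col_space[OF cA rank])
  then obtain x where x: "x \<in> carrier_vec k" and e: "unit_vec n i = ?A *\<^sub>v x"
    by auto
  have "transpose_mat ?A *\<^sub>v ?y = map_vec rat_of_int (transpose_mat A *\<^sub>v y)"
    using A y by (subst of_int_hom.mult_mat_vec_hom[of _ k n]) (auto simp: map_mat_transpose)
  also have "\<dots> = 0\<^sub>v k"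
    by (auto simp: ker)
  finally have "0 = (transpose_mat ?A *\<^sub>v ?y) \<bullet> x"
    using x by simp
  also have "\<dots> = ?y \<bullet> (?A *\<^sub>v x)"
    using transpose_vec_mult_scalar[OF cA x cy] .
  also have "\<dots> = rat_of_int (y $ i)"
    using y i by (simp flip: e)
  finally show "y $ i = 0\<^sub>v n $ i" using i by simp
qed (use y in simp)

text \<open>The second row of blocks has height zero; the block form makes the product rules for four-block
matrices available.\<close>

definition append_cols :: "'a::zero mat \<Rightarrow> 'a mat \<Rightarrow> 'a mat" where
  "append_cols A B = four_block_mat A B (0\<^sub>m 0 (dim_col A)) (0\<^sub>m 0 (dim_col B))"

lemma append_cols_carrier [simp, intro]:
  "A \<in> carrier_mat m k \<Longrightarrow> B \<in> carrier_mat m l \<Longrightarrow> append_cols A B \<in> carrier_mat m (k + l)"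
  unfolding append_cols_def by auto

lemma append_cols_mult_vec:
  fixes A :: "'a::comm_ring_1 mat"
  assumes A: "A \<in> carrier_mat m k" and B: "B \<in> carrier_mat m l"
    and a: "a \<in> carrier_vec k" and b: "b \<in> carrier_vec l"
  shows "append_cols A B *\<^sub>v (a @\<^sub>v b) = A *\<^sub>v a + B *\<^sub>v b"
  unfolding append_cols_def using assms
  by (subst four_block_mat_mult_vec[OF A B _ _ a b]) (auto intro!: eq_vecI)

lemma append_rows_mult_append_cols:
  fixes A :: "'a::comm_ring_1 mat"
  assumes "A \<in> carrier_mat m p" and "B \<in> carrier_mat q p"
    and "C \<in> carrier_mat p k" and "D \<in> carrier_mat p l"
  shows "(A @\<^sub>r B) * append_cols C D = four_block_mat (A * C) (A * D) (B * C) (B * D)"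
  unfolding append_rows_def append_cols_def using assms
  by (subst mult_four_block_mat[of _ m p _ 0 _ q _ _ k _ l]) (auto intro!: cong_four_block_mat eq_matI)

lemma split_columns:
  fixes U :: "'a::zero mat"
  assumes U: "U \<in> carrier_mat m (k + l)"
  obtains U1 U2 where "U1 \<in> carrier_mat m k" and "U2 \<in> carrier_mat m l" and "U = append_cols U1 U2"
    and "\<And>j. j < l \<Longrightarrow> col U2 j = col U (k + j)"
proof -
  let ?U1 = "mat m k (\<lambda>(i, j). U $$ (i, j))" and ?U2 = "mat m l (\<lambda>(i, j). U $$ (i, k + j))"
  have "U = append_cols ?U1 ?U2"
    using U by (intro eq_matI) (auto simp: append_cols_def)
  moreover have "col ?U2 j = col U (k + j)" if "j < l" for j
    using U that by (intro eq_vecI) auto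
  ultimately show thesis using that[of ?U1 ?U2] by auto
qed

text \<open>If \<open>P V U\<close> is diagonal, its last \<open>r\<close> columns vanish, and so do those of \<open>V U\<close> because \<open>P\<close> is
invertible. This gives \<open>V U = [V C, 0]\<close> where \<open>U = [C, K]\<close>. A vector \<open>y\<close> that is orthogonal to the
columns of \<open>V C\<close> is then orthogonal to all columns of \<open>V\<close>, hence zero by the rank hypothesis; so
\<open>V C\<close> is nonsingular.\<close>

lemma full_rank_column_reduction:
  assumes V: "V \<in> carrier_mat n (n + r)" and rank: "vec_space.rank n (map_mat rat_of_int V) = n"
  obtains C K where "C \<in> carrier_mat (n + r) n" and "K \<in> carrier_mat (n + r) r"
    and "unimodular (n + r) (append_cols C K)" and "det (V * C) \<noteq> 0" and "V * K = 0\<^sub>m n r"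
proof -
  obtain D where "unimodular_equiv V D" and diag: "diagonal_mat D"
    using smith_diagonalisation[OF V] .
  then obtain P U where P: "unimodular n P" and U: "unimodular (n + r) U" and D: "D = P * V * U"
    using V by (auto simp: unimodular_equiv_def)
  obtain P' where P': "unimodular n P'" "P' * P = 1\<^sub>m n"
    using unimodular_inverse[OF P] .
  note cP = unimodular_carrier[OF P] and cU = unimodular_carrier[OF U]
    and cP' = unimodular_carrier[OF P'(1)]
  have cVU: "V * U \<in> carrier_mat n (n + r)" using V cU by simp
  have cD: "D \<in> carrier_mat n (n + r)" using V cU cP by (simp add: D)
  have "P' * D = P' * (P * (V * U))"
    by (simp add: D assoc_mult_mat[OF cP V cU])
  also have "\<dots> = (P' * P) * (V * U)"
    by (rule assoc_mult_mat[OF cP' cP cVU, symmetric])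
  also have "\<dots> = V * U"
    unfolding P'(2) by (rule left_mult_one_mat[OF cVU])
  finally have VU: "V * U = P' * D" ..
  obtain C K where C: "C \<in> carrier_mat (n + r) n" and K: "K \<in> carrier_mat (n + r) r"
    and UCK: "U = append_cols C K" and colK: "\<And>j. j < r \<Longrightarrow> col K j = col U (n + j)"
    using split_columns[OF cU] by blast
  have VK: "V * K = 0\<^sub>m n r"
  proof (rule eq_matI)
    fix i j assume "i < dim_row (0\<^sub>m n r :: int mat)" "j < dim_col (0\<^sub>m n r :: int mat)"
    then have i: "i < n" and j: "j < r" by auto
    have "(V * K) $$ (i, j) = (V * U) $$ (i, n + j)"
      using i j V K cU by (simp add: colK)
    also have "\<dots> = row P' i \<bullet> col D (n + j)"
      using i j cP' cD by (simp add: VU)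
    also have "col D (n + j) = 0\<^sub>v n"
      using diag cD j by (intro eq_vecI) (auto simp: diagonal_mat_def)
    finally show "(V * K) $$ (i, j) = 0\<^sub>m n r $$ (i, j)"
      using i j cP' by simp
  qed (use V K in auto)
  have cVC: "V * C \<in> carrier_mat n n" using V C by simp
  have "det (V * C) \<noteq> 0"
  proof
    assume "det (V * C) = 0"
    then have "det (transpose_mat (V * C)) = 0" by (simp add: det_transpose[OF cVC])
    then obtain y where y: "y \<in> carrier_vec n" "y \<noteq> 0\<^sub>v n"
      and VCy: "transpose_mat (V * C) *\<^sub>v y = 0\<^sub>v n"
      using det_0_iff_vec_prod_zero[of "transpose_mat (V * C)" n] cVC by auto
    \<comment> \<open>\<open>z\<close> is orthogonal to the columns of \<open>C\<close> and of \<open>K\<close>, which span the whole lattice.\<close>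
    define z where "z = transpose_mat V *\<^sub>v y"
    have z: "z \<in> carrier_vec (n + r)" using V y by (simp add: z_def)
    have Cz: "transpose_mat C *\<^sub>v z = 0\<^sub>v n"
      unfolding VCy[symmetric] z_def transpose_mult[OF V C]
      by (rule assoc_mult_mat_vec[symmetric]) (use V C y in auto)
    have Kz: "transpose_mat K *\<^sub>v z = 0\<^sub>v r"
    proof -
      have "transpose_mat K *\<^sub>v z = transpose_mat (V * K) *\<^sub>v y"
        unfolding z_def transpose_mult[OF V K]
        by (rule assoc_mult_mat_vec[symmetric]) (use V K y in auto)
      then show ?thesis using y by (auto simp: VK)
    qed
    have "z $ i = 0" if i: "i < n + r" for i
    proof -
      have "unit_vec (n + r) i \<in> (*\<^sub>v) U ` carrier_vec (n + r)"
        using unimodular_mult_vec_bij[OF U] by (simp add: bij_betw_def)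
      then obtain w where w: "w \<in> carrier_vec (n + r)" and e: "unit_vec (n + r) i = U *\<^sub>v w"
        by blast
      have "U *\<^sub>v w = U *\<^sub>v (vec_first w n @\<^sub>v vec_last w r)"
        using w by simp
      also have "\<dots> = C *\<^sub>v vec_first w n + K *\<^sub>v vec_last w r"
        unfolding UCK by (rule append_cols_mult_vec[OF C K]) auto
      finally have "z \<bullet> unit_vec (n + r) i = z \<bullet> (C *\<^sub>v vec_first w n) + z \<bullet> (K *\<^sub>v vec_last w r)"
        using z C K by (simp add: e scalar_prod_add_distrib[of _ "n + r"])
      also have "\<dots> = 0"
        using transpose_vec_mult_scalar[OF C _ z, of "vec_first w n"]
          transpose_vec_mult_scalar[OF K _ z, of "vec_last w r"] by (simp add: Cz Kz)
      finally show ?thesis using z i by simp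
    qed
    then have "transpose_mat V *\<^sub>v y = 0\<^sub>v (n + r)"
      using z by (intro eq_vecI) (auto simp: z_def[symmetric])
    then show False
      using full_rank_left_kernel[OF V rank y(1)] y(2) by simp
  qed
  then show thesis
    using that[OF C K] U VK by (simp add: UCK)
qed

section \<open>Completing a kernel basis to a unimodular matrix\<close>

lemma gale_dual_kernel:
  assumes V: "V \<in> carrier_mat n (n + r)" and Q: "gale_dual V Q"
  shows "Q \<in> carrier_mat r (n + r)"
    and "mat_kernel V = (*\<^sub>v) (transpose_mat Q) ` carrier_vec r"
proof -
  show c: "Q \<in> carrier_mat r (n + r)"
    using Q V by (simp add: gale_dual_def)
  have "int_span (n + r) (set (cols (transpose_mat Q))) = mat_kernel V"
    using Q V by (simp add: gale_dual_def)
  then show "mat_kernel V = (*\<^sub>v) (transpose_mat Q) ` carrier_vec r"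
    using int_span_cols[of "transpose_mat Q" "n + r" r] c by simp
qed

lemma factor_through_image:
  fixes A :: "int mat"
  assumes "A \<in> carrier_mat m k" and "B \<in> carrier_mat m l"
    and "\<And>j. j < l \<Longrightarrow> col B j \<in> (*\<^sub>v) A ` carrier_vec k"
  obtains G where "G \<in> carrier_mat k l" and "B = A * G"
proof -
  have "\<forall>j<l. \<exists>g. g \<in> carrier_vec k \<and> col B j = A *\<^sub>v g"
    using assms(3) by blast
  then obtain g where g: "\<And>j. j < l \<Longrightarrow> g j \<in> carrier_vec k" "\<And>j. j < l \<Longrightarrow> col B j = A *\<^sub>v g j"
    by metis
  let ?G = "mat_of_cols k (map g [0..<l])"
  have "B = A * ?G"
    using assms(1,2) g by (intro eq_matI) (auto simp flip: index_col[of _ B])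
  moreover have "?G \<in> carrier_mat k l"
    using mat_of_cols_carrier(1)[of k "map g [0..<l]"] by simp
  ultimately show thesis by (rule that[rotated])
qed

text \<open>Preimages of the unit vectors are the columns of a right inverse.\<close>

lemma unimodular_if_surj:
  assumes B: "B \<in> carrier_mat n n" and surj: "carrier_vec n \<subseteq> (*\<^sub>v) B ` carrier_vec n"
  shows "unimodular n B"
proof -
  have "col (1\<^sub>m n) j \<in> (*\<^sub>v) B ` carrier_vec n" if "j < n" for j
    using surj that by auto
  then obtain G where "G \<in> carrier_mat n n" and "1\<^sub>m n = B * G"
    using factor_through_image[OF B one_carrier_mat] by blast
  then show ?thesis
    using unimodular_factors(1)[OF B] by simp
qed

text \<open>In the unimodular matrix \<open>[C, K]\<close> of the column reduction the columns of \<open>K\<close> lie in the kernel of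
\<open>V\<close>, so they are integral combinations of the rows of \<open>Q\<close>. Replacing \<open>K\<close> by \<open>Q\<^sup>T\<close> therefore keeps
the columns generating, and a square integer matrix with generating columns is unimodular.\<close>

lemma kernel_basis_completion:
  assumes V: "V \<in> carrier_mat n (n + r)" and rank: "vec_space.rank n (map_mat rat_of_int V) = n"
    and Q: "gale_dual V Q"
  obtains C where "C \<in> carrier_mat (n + r) n" and "det (V * C) \<noteq> 0"
    and "unimodular (n + r) (append_cols C (transpose_mat Q))"
proof -
  obtain C K where C: "C \<in> carrier_mat (n + r) n" and K: "K \<in> carrier_mat (n + r) r"
    and U: "unimodular (n + r) (append_cols C K)" and nz: "det (V * C) \<noteq> 0" and VK: "V * K = 0\<^sub>m n r"
    using full_rank_column_reduction[OF V rank] .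
  have cQ: "transpose_mat Q \<in> carrier_mat (n + r) r"
    using gale_dual_kernel(1)[OF V Q] by simp
  have "x \<in> (*\<^sub>v) (append_cols C (transpose_mat Q)) ` carrier_vec (n + r)"
    if x: "x \<in> carrier_vec (n + r)" for x
  proof -
    obtain w where w: "w \<in> carrier_vec (n + r)" and xw: "x = append_cols C K *\<^sub>v w"
      using x unimodular_mult_vec_bij[OF U] by (auto simp: bij_betw_def)
    define a b where "a = vec_first w n" and "b = vec_last w r"
    have a: "a \<in> carrier_vec n" and b: "b \<in> carrier_vec r" by (auto simp: a_def b_def)
    have "x = C *\<^sub>v a + K *\<^sub>v b"
      using append_cols_mult_vec[OF C K a b] w by (simp add: xw a_def b_def)
    moreover have "K *\<^sub>v b \<in> mat_kernel V"
    proof (rule mat_kernelI[OF V])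
      have "V *\<^sub>v (K *\<^sub>v b) = (V * K) *\<^sub>v b"
        by (rule assoc_mult_mat_vec[OF V K b, symmetric])
      then show "V *\<^sub>v (K *\<^sub>v b) = 0\<^sub>v n" using b by (auto simp: VK)
    qed (use K b in auto)
    then obtain c where c: "c \<in> carrier_vec r" and "K *\<^sub>v b = transpose_mat Q *\<^sub>v c"
      unfolding gale_dual_kernel(2)[OF V Q] by blast
    ultimately have "x = append_cols C (transpose_mat Q) *\<^sub>v (a @\<^sub>v c)"
      using append_cols_mult_vec[OF C cQ a c] by simp
    then show ?thesis using a c by (intro image_eqI) auto
  qed
  then have "unimodular (n + r) (append_cols C (transpose_mat Q))"
    using C cQ by (intro unimodular_if_surj) auto
  with C nz show thesis by (rule that)
qed

lemma kernel_basis_mult_zero: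
  assumes V: "V \<in> carrier_mat n (n + r)" and Q: "gale_dual V Q"
  shows "V * transpose_mat Q = 0\<^sub>m n r"
proof (rule eq_matI)
  note cQ = gale_dual_kernel(1)[OF V Q]
  fix i j assume "i < dim_row (0\<^sub>m n r :: int mat)" "j < dim_col (0\<^sub>m n r :: int mat)"
  then have i: "i < n" and j: "j < r" by auto
  have "transpose_mat Q *\<^sub>v unit_vec r j \<in> mat_kernel V"
    unfolding gale_dual_kernel(2)[OF V Q] by (intro imageI) auto
  then have "V *\<^sub>v (transpose_mat Q *\<^sub>v unit_vec r j) = 0\<^sub>v n"
    using mat_kernelD(2)[OF V] by blast
  moreover have "transpose_mat Q *\<^sub>v unit_vec r j = col (transpose_mat Q) j"
    using cQ j by (intro eq_vecI) auto
  ultimately have "V *\<^sub>v col (transpose_mat Q) j = 0\<^sub>v n" by simp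
  from arg_cong[OF this, of "\<lambda>v. v $ i"]
  show "(V * transpose_mat Q) $$ (i, j) = 0\<^sub>m n r $$ (i, j)"
    using i j V cQ by simp
qed (use V gale_dual_kernel(1)[OF V Q] in auto)

text \<open>\<open>V\<close> annihilates the part of \<open>\<int>\<^sup>n\<^sup>+\<^sup>r\<close> generated by \<open>K\<close>, so its image is already that of the
part generated by \<open>C\<close>.\<close>

lemma col_lattice_kernel_complement:
  assumes V: "V \<in> carrier_mat n (n + r)"
    and C: "C \<in> carrier_mat (n + r) n" and K: "K \<in> carrier_mat (n + r) r"
    and VK: "V * K = 0\<^sub>m n r" and uni: "unimodular (n + r) (append_cols C K)"
  shows "col_lattice V = col_lattice (V * C)"
proof -
  have split: "V *\<^sub>v (append_cols C K *\<^sub>v (a @\<^sub>v b)) = V *\<^sub>v (C *\<^sub>v a)"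
    if a: "a \<in> carrier_vec n" and b: "b \<in> carrier_vec r" for a b
  proof -
    have "V *\<^sub>v (K *\<^sub>v b) = (V * K) *\<^sub>v b"
      by (rule assoc_mult_mat_vec[OF V K b, symmetric])
    also have "\<dots> = 0\<^sub>v n" using b by (auto simp: VK)
    finally show ?thesis
      using V C K a b
      by (simp add: append_cols_mult_vec[OF C K a b] mult_add_distrib_mat_vec[OF V])
  qed
  have "col_lattice V = (*\<^sub>v) V ` (*\<^sub>v) (append_cols C K) ` carrier_vec (n + r)"
    using unimodular_mult_vec_bij[OF uni] by (simp add: col_lattice_eq[OF V] bij_betw_def)
  also have "\<dots> = (*\<^sub>v) V ` (*\<^sub>v) C ` carrier_vec n"
  proof (intro equalityI subsetI)
    fix y assume "y \<in> (*\<^sub>v) V ` (*\<^sub>v) (append_cols C K) ` carrier_vec (n + r)"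
    then obtain w where w: "w \<in> carrier_vec (n + r)" and y: "y = V *\<^sub>v (append_cols C K *\<^sub>v w)"
      by blast
    have "y = V *\<^sub>v (C *\<^sub>v vec_first w n)"
      using split[of "vec_first w n" "vec_last w r"] w by (simp add: y)
    then show "y \<in> (*\<^sub>v) V ` (*\<^sub>v) C ` carrier_vec n" by simp
  next
    fix y assume "y \<in> (*\<^sub>v) V ` (*\<^sub>v) C ` carrier_vec n"
    then obtain a where a: "a \<in> carrier_vec n" and y: "y = V *\<^sub>v (C *\<^sub>v a)" by blast
    have "y = V *\<^sub>v (append_cols C K *\<^sub>v (a @\<^sub>v 0\<^sub>v r))"
      using split[OF a zero_carrier_vec] by (simp add: y)
    moreover have "a @\<^sub>v 0\<^sub>v r \<in> carrier_vec (n + r)" using a by simp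
    ultimately show "y \<in> (*\<^sub>v) V ` (*\<^sub>v) (append_cols C K) ` carrier_vec (n + r)" by blast
  qed
  also have "\<dots> = col_lattice (V * C)"
    by (simp add: col_lattice_mult[OF V C] col_lattice_eq[OF C])
  finally show ?thesis .
qed

section \<open>Complementary maximal minors\<close>

definition col_selector :: "nat \<Rightarrow> nat set \<Rightarrow> int mat" where
  "col_selector N J = submatrix (1\<^sub>m N) UNIV J"

lemma pick_mem_less:
  assumes "J \<subseteq> {0..<N}" and "j < card J"
  shows "pick J j \<in> J" and "pick J j < N"
  using pick_in_set_le[OF assms(2)] assms(1) by auto

lemma submatrix_columns:
  assumes M: "M \<in> carrier_mat m N" and J: "J \<subseteq> {0..<N}"
  shows "submatrix M UNIV J \<in> carrier_mat m (card J)"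
    and "\<And>i j. i < m \<Longrightarrow> j < card J \<Longrightarrow> submatrix M UNIV J $$ (i, j) = M $$ (i, pick J j)"
proof -
  have "{j. j < dim_col M \<and> j \<in> J} = J" using M J by auto
  then show "submatrix M UNIV J \<in> carrier_mat m (card J)"
    "\<And>i j. i < m \<Longrightarrow> j < card J \<Longrightarrow> submatrix M UNIV J $$ (i, j) = M $$ (i, pick J j)"
    using M by (auto simp: submatrix_def pick_UNIV)
qed

lemma col_selector:
  assumes J: "J \<subseteq> {0..<N}"
  shows "col_selector N J \<in> carrier_mat N (card J)"
    and "\<And>j. j < card J \<Longrightarrow> col (col_selector N J) j = unit_vec N (pick J j)"
proof -
  show c: "col_selector N J \<in> carrier_mat N (card J)"
    unfolding col_selector_def by (rule submatrix_columns(1)[OF one_carrier_mat J])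
  fix j assume j: "j < card J"
  have "col_selector N J $$ (i, j) = unit_vec N (pick J j) $ i" if "i < N" for i
    using submatrix_columns(2)[OF one_carrier_mat J that j] pick_mem_less(2)[OF J j] that
    by (simp add: col_selector_def)
  then show "col (col_selector N J) j = unit_vec N (pick J j)"
    using c j by (intro eq_vecI) auto
qed

lemma mult_col_selector:
  assumes M: "M \<in> carrier_mat m N" and J: "J \<subseteq> {0..<N}"
  shows "M * col_selector N J = submatrix M UNIV J"
  using M submatrix_columns[OF M J] col_selector[OF J] pick_mem_less[OF J]
  by (intro eq_matI) auto

lemma col_selector_orthogonal:
  assumes J: "J \<subseteq> {0..<N}" and K: "K \<subseteq> {0..<N}"
  shows "transpose_mat (col_selector N J) * col_selector N K =
    mat (card J) (card K) (\<lambda>(i, j). if pick J i = pick K j then 1 else 0)"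
  using col_selector[OF J] col_selector[OF K] pick_mem_less[OF J] pick_mem_less[OF K]
  by (intro eq_matI) auto

text \<open>The columns of \<open>[E, F]\<close>, the selectors of \<open>I\<close> and of its complement \<open>J\<close>, are all the unit vectors in
some order, so this matrix is unimodular. Multiplying by it from the right brings the columns in \<open>I\<close>
to the front, which turns \<open>[V; F\<^sup>T]\<close> into the block triangular matrix with diagonal blocks \<open>V\<^sub>I\<close> and
the identity.\<close>

lemma abs_det_block_complement:
  assumes V: "V \<in> carrier_mat n (n + r)" and I: "I \<subseteq> {0..<n + r}" and card: "card I = n"
    and "J = {0..<n + r} - I"
  shows "\<bar>det (V @\<^sub>r transpose_mat (col_selector (n + r) J))\<bar> = \<bar>det (submatrix V UNIV I)\<bar>"
proof -
  let ?N = "n + r"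
  let ?E = "col_selector ?N I" and ?F = "col_selector ?N J"
  have J: "J \<subseteq> {0..<?N}" and cardJ: "card J = r"
    using assms by (auto simp: card_Diff_subset finite_subset)
  have E: "?E \<in> carrier_mat ?N n" and F: "?F \<in> carrier_mat ?N r"
    using col_selector(1)[OF I] col_selector(1)[OF J] card cardJ by auto
  have inj: "pick L i = pick L j \<longleftrightarrow> i = j" if "i < card L" "j < card L" for L i j
    using pick_mono_le that by (metis linorder_neqE_nat less_irrefl)
  have disj: "pick I i \<noteq> pick J j" if "i < n" "j < r" for i j
    using pick_mem_less(1)[OF I, of i] pick_mem_less(1)[OF J, of j] that card cardJ assms(4) by auto
  have EE: "transpose_mat ?E * ?E = 1\<^sub>m n"
    unfolding col_selector_orthogonal[OF I I] by (intro eq_matI) (auto simp: inj card)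
  have FF: "transpose_mat ?F * ?F = 1\<^sub>m r"
    unfolding col_selector_orthogonal[OF J J] by (intro eq_matI) (auto simp: inj cardJ)
  have EF: "transpose_mat ?E * ?F = 0\<^sub>m n r"
    unfolding col_selector_orthogonal[OF I J] by (intro eq_matI) (auto simp: disj card cardJ)
  have FE: "transpose_mat ?F * ?E = 0\<^sub>m r n"
    unfolding col_selector_orthogonal[OF J I] 
    by (intro eq_matI) (auto simp: disj[symmetric] card cardJ)
  have "(transpose_mat ?E @\<^sub>r transpose_mat ?F) * append_cols ?E ?F = 1\<^sub>m ?N"
    using E F by (subst append_rows_mult_append_cols[of _ n ?N _ r _ n _ r]) (auto simp: EE FF EF FE)
  then have uni: "unimodular ?N (append_cols ?E ?F)"
    by (rule unimodular_factors(2)[rotated 2]) (use E F in auto)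
  have VF: "V @\<^sub>r transpose_mat ?F \<in> carrier_mat ?N ?N"
    using V F by auto
  have "(V @\<^sub>r transpose_mat ?F) * append_cols ?E ?F =
      four_block_mat (submatrix V UNIV I) (V * ?F) (0\<^sub>m r n) (1\<^sub>m r)"
    using V E F
    by (subst append_rows_mult_append_cols[of _ n ?N _ r _ n _ r])
      (auto simp: FF FE mult_col_selector[OF V I])
  then have "det ((V @\<^sub>r transpose_mat ?F) * append_cols ?E ?F) = det (submatrix V UNIV I)"
    using V F submatrix_columns(1)[OF V I] card
    by (simp add: det_four_block_mat_lower_left_zero[of _ n _ r])
  then have "\<bar>det (V @\<^sub>r transpose_mat ?F)\<bar> * \<bar>det (append_cols ?E ?F)\<bar> = \<bar>det (submatrix V UNIV I)\<bar>"
    unfolding abs_mult[symmetric] det_mult[OF VF unimodular_carrier[OF uni]] by simp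
  then show ?thesis
    using uni by (simp add: unimodular_def)
qed

text \<open>A second evaluation of the determinant of \<open>[V; F\<^sup>T]\<close>, where \<open>F\<close> selects the complement of \<open>I\<close>.
Multiplying from the right by the unimodular matrix \<open>[C, Q\<^sup>T]\<close> puts \<open>V Q\<^sup>T = 0\<close> in the upper right
corner, with diagonal blocks \<open>V C\<close> and \<open>F\<^sup>T Q\<^sup>T\<close>; the latter is the transpose of the columns of \<open>Q\<close>
outside \<open>I\<close>.\<close>

lemma abs_det_submatrix_eq:
  assumes V: "V \<in> carrier_mat n (n + r)" and I: "I \<subseteq> {0..<n + r}" and card: "card I = n"
    and C: "C \<in> carrier_mat (n + r) n" and Q: "Q \<in> carrier_mat r (n + r)"
    and VQ: "V * transpose_mat Q = 0\<^sub>m n r"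
    and uni: "unimodular (n + r) (append_cols C (transpose_mat Q))"
  shows "\<bar>det (V * C)\<bar> * \<bar>det (submatrix Q UNIV ({0..<n + r} - I))\<bar> = \<bar>det (submatrix V UNIV I)\<bar>"
proof -
  let ?N = "n + r"
  define J where "J = {0..<?N} - I"
  let ?F = "col_selector ?N J"
  have J: "J \<subseteq> {0..<?N}" and cardJ: "card J = r"
    using I card by (auto simp: J_def card_Diff_subset finite_subset)
  have F: "?F \<in> carrier_mat ?N r"
    using col_selector(1)[OF J] cardJ by simp
  have VF: "V @\<^sub>r transpose_mat ?F \<in> carrier_mat ?N ?N"
    using V F by auto
  have QJ: "submatrix Q UNIV J \<in> carrier_mat r r"
    using submatrix_columns(1)[OF Q J] cardJ by simp
  have FQ: "transpose_mat ?F * transpose_mat Q = transpose_mat (submatrix Q UNIV J)"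
    using transpose_mult[OF Q F] by (simp add: mult_col_selector[OF Q J])
  have "(V @\<^sub>r transpose_mat ?F) * append_cols C (transpose_mat Q) =
      four_block_mat (V * C) (0\<^sub>m n r) (transpose_mat ?F * C) (transpose_mat (submatrix Q UNIV J))"
    using V F C Q
    by (subst append_rows_mult_append_cols[of _ n ?N _ r _ n _ r]) (auto simp: VQ FQ)
  then have "det ((V @\<^sub>r transpose_mat ?F) * append_cols C (transpose_mat Q)) =
      det (V * C) * det (submatrix Q UNIV J)"
    using V F C QJ
    by (simp add: det_four_block_mat_upper_right_zero[of _ n _ r] det_transpose[OF QJ])
  moreover have "\<bar>det ((V @\<^sub>r transpose_mat ?F) * append_cols C (transpose_mat Q))\<bar> =
      \<bar>det (V @\<^sub>r transpose_mat ?F)\<bar>"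
    using uni det_mult[OF VF unimodular_carrier[OF uni]] by (simp add: unimodular_def abs_mult)
  ultimately show ?thesis
    using abs_det_block_complement[OF V I card J_def] by (simp add: J_def abs_mult)
qed

section \<open>Index and maximal minors of Gale dual matrices\<close>

theorem corollary3p3:
  fixes n r :: nat and V Q :: "int mat" and I :: "nat set"
  assumes "n > 0" and "r > 0"
    and "V \<in> carrier_mat n (n + r)"
    and "vec_space.rank n (map_mat rat_of_int V) = n"
    and "gale_dual V Q"
    and "I \<subseteq> {0..<n + r}" and "card I = n"
  shows "finite (rcosets\<^bsub>int_lattice n\<^esub> (col_lattice V)) \<and>
    int (subgroup_index (int_lattice n) (col_lattice V)) *
        \<bar>det (submatrix Q UNIV ({0..<n + r} - I))\<bar> = \<bar>det (submatrix V UNIV I)\<bar> \<and>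
    (no_cotorsion n (col_lattice V) \<longrightarrow>
        \<bar>det (submatrix Q UNIV ({0..<n + r} - I))\<bar> = \<bar>det (submatrix V UNIV I)\<bar>)"
proof -
  note V = assms(3) and Q = assms(5)
  note cQ = gale_dual_kernel(1)[OF V Q] and VQ = kernel_basis_mult_zero[OF V Q]
  obtain C where C: "C \<in> carrier_mat (n + r) n" and nz: "det (V * C) \<noteq> 0"
    and uni: "unimodular (n + r) (append_cols C (transpose_mat Q))"
    using kernel_basis_completion[OF V assms(4) Q] .
  have VC: "V * C \<in> carrier_mat n n" using V C by simp
  have eq: "col_lattice V = col_lattice (V * C)"
    using col_lattice_kernel_complement[OF V C _ VQ uni] cQ by simp
  note index = index_col_lattice_square[OF VC nz, folded eq]
  have formula: "int (subgroup_index (int_lattice n) (col_lattice V)) *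
      \<bar>det (submatrix Q UNIV ({0..<n + r} - I))\<bar> = \<bar>det (submatrix V UNIV I)\<bar>"
    unfolding index(2) by (rule abs_det_submatrix_eq[OF V assms(6,7) C cQ VQ uni])
  moreover have "subgroup_index (int_lattice n) (col_lattice V) = 1"
    if "no_cotorsion n (col_lattice V)"
    using finite_torsion_free_index[OF comm_group_vec subgroup_col_lattice[OF V] index(1)] that
    by (simp add: no_cotorsion_def)
  ultimately show ?thesis using index(1) by auto
qed

end
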